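(* Let $b_0,b_1,b_2,\dots$ be indeterminates, $B(x)=\sum_{i\ge0}b_ix^i$, and let $g(x)$ be the unique formal power series with $g(x)=1+xg(x)B(x^2g(x))$. For a positive integer $m$ let $\left(m\,|\,b_0^{m_0}\cdots b_p^{m_p}\right)$ denote the coefficient of the monomial $b_0^{m_0}\cdots b_p^{m_p}$ in $[x^n]g^m(x)$, where $n=\sum_{i=0}^p m_i(2i+1)\ge1$. Then $$\left(m\,|\,b_0^{m_0}b_1^{m_1}\cdots b_p^{m_p}\right)=\sum_{r=0}^{p}\ \sum_{i=r+1}^{m+r}\left(i\,|\,b_0^{m_0}\cdots b_{r-1}^{m_{r-1}}b_r^{m_r-1}b_{r+1}^{m_{r+1}}\cdots b_p^{m_p}\right),$$ with the convention that $\left(i\,|\,\cdots b_r^{-1}\cdots\right)=0$.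
   Context: $[x^n]F(x)$ denotes the coefficient of $x^n$ in $F$. The coefficient of the empty monomial (all exponents zero) is $[x^0]g^i(x)=1$, i.e. $\left(i\,|\,b_0^0\cdots b_p^0\right)=1$. *)

theory Defs
  imports
    "HOL-Library.Poly_Mapping"
    "HOL-Computational_Algebra.Formal_Power_Series"
begin

text \<open>
  Polynomials in the indeterminates \<open>b\<^sub>0, b\<^sub>1, \<dots>\<close> over a commutative ring: a monomial is a
  finitely supported exponent map \<open>nat \<Rightarrow>\<^sub>0 nat\<close>, and a polynomial is a finitely supported
  map from monomials to coefficients, with the convolution product of \<open>Poly_Mapping\<close>.
\<close>

type_synonym 'a bpoly = "(nat \<Rightarrow>\<^sub>0 nat) \<Rightarrow>\<^sub>0 'a"

definition indet :: "nat \<Rightarrow> 'a::comm_ring_1 bpoly" where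
  "indet i = Poly_Mapping.single (Poly_Mapping.single i 1) 1"

definition Bser :: "'a::comm_ring_1 bpoly fps" where
  "Bser = Abs_fps indet"

definition gser :: "'a::comm_ring_1 bpoly fps" where
  "gser = (THE g. g = 1 + fps_X * g * (Bser oo (fps_X ^ 2 * g)))"

definition bmonom :: "nat \<Rightarrow> (nat \<Rightarrow> nat) \<Rightarrow> (nat \<Rightarrow>\<^sub>0 nat)" where
  "bmonom p e = (\<Sum>i\<le>p. Poly_Mapping.single i (e i))"

definition bcoeff :: "nat \<Rightarrow> nat \<Rightarrow> (nat \<Rightarrow> nat) \<Rightarrow> 'a::comm_ring_1" where
  "bcoeff m p e =
     Poly_Mapping.lookup (fps_nth (gser ^ m) (\<Sum>i\<le>p. e i * (2 * i + 1))) (bmonom p e)"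

text \<open>
  The description in \<open>gser_def\<close> is proper: the right-hand side of the equation is contracting
  for the \<open>X\<close>-adic topology.
\<close>

lemma mult_agree:
  fixes f g f' g' :: "'a::comm_ring_1 fps"
  assumes "\<And>k. k < n \<Longrightarrow> fps_nth f k = fps_nth f' k"
    and "\<And>k. k < n \<Longrightarrow> fps_nth g k = fps_nth g' k"
    and "k < n"
  shows "fps_nth (f * g) k = fps_nth (f' * g') k"
  using assms by (auto simp: fps_mult_nth intro!: sum.cong)

lemma power_agree:
  fixes f f' :: "'a::comm_ring_1 fps"
  assumes "\<And>k. k < n \<Longrightarrow> fps_nth f k = fps_nth f' k" and "k < n"
  shows "fps_nth (f ^ i) k = fps_nth (f' ^ i) k"
  using assms(2)
proof (induction i arbitrary: k)
  case (Suc i)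
  then show ?case
    using mult_agree[of n f f' "f ^ i" "f' ^ i" k] assms(1) by simp
qed simp

lemma step_agree:
  fixes B g h :: "'a::comm_ring_1 fps"
  assumes "\<And>k. k < n \<Longrightarrow> fps_nth g k = fps_nth h k" and "k < Suc n"
  shows "fps_nth (1 + fps_X * g * (B oo (fps_X ^ 2 * g))) k
       = fps_nth (1 + fps_X * h * (B oo (fps_X ^ 2 * h))) k"
proof (cases k)
  case 0
  then show ?thesis by (simp add: fps_mult_nth_0)
next
  case (Suc j)
  have "fps_nth (fps_X ^ 2 * g) k = fps_nth (fps_X ^ 2 * h) k" if "k < n" for k
    using that by (intro mult_agree[of n]) (auto simp: assms(1))
  then have "fps_nth (B oo (fps_X ^ 2 * g)) k = fps_nth (B oo (fps_X ^ 2 * h)) k"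
    if "k < n" for k
    using that power_agree[of n "fps_X ^ 2 * g" "fps_X ^ 2 * h"]
    by (simp add: fps_compose_nth)
  then have "fps_nth (g * (B oo (fps_X ^ 2 * g))) j = fps_nth (h * (B oo (fps_X ^ 2 * h))) j"
    using assms Suc by (intro mult_agree[of n]) auto
  then show ?thesis
    using Suc by (simp add: mult.assoc)
qed

lemma functional_equation_unique:
  fixes B :: "'a::comm_ring_1 fps"
  shows "\<exists>!g. g = 1 + fps_X * g * (B oo (fps_X ^ 2 * g))"
proof -
  define F where "F g = 1 + fps_X * g * (B oo (fps_X ^ 2 * g))" for g
  have F: "fps_nth (F g) k = fps_nth (F h) k"
    if "\<And>k. k < n \<Longrightarrow> fps_nth g k = fps_nth h k" "k < Suc n" for g h n k
    unfolding F_def by (rule step_agree[OF that])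
  have iter: "fps_nth ((F ^^ n) g) k = fps_nth ((F ^^ n) h) k" if "k < n" for n k g h
    using that
  proof (induction n arbitrary: k)
    case (Suc n)
    then show ?case
      using F[of n "(F ^^ n) g" "(F ^^ n) h" k] by simp
  qed simp
  define G where "G = Abs_fps (\<lambda>k. fps_nth ((F ^^ Suc k) 0) k)"
  have G: "fps_nth G k = fps_nth ((F ^^ n) 0) k" if kn: "k < n" for n k
  proof -
    obtain d where d: "n = Suc k + d"
      using kn by (metis add_Suc less_iff_Suc_add)
    have "fps_nth ((F ^^ Suc k) 0) k = fps_nth ((F ^^ Suc k) ((F ^^ d) 0)) k"
      by (rule iter) simp
    also have "(F ^^ Suc k) ((F ^^ d) 0) = (F ^^ n) 0"
      unfolding d funpow_add by simp
    finally show ?thesis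
      by (simp add: G_def)
  qed
  have fixG: "G = F G"
  proof (rule fps_ext)
    fix k
    have "fps_nth (F G) k = fps_nth (F ((F ^^ k) 0)) k"
      by (rule F[of k]) (auto intro: G)
    then show "fps_nth G k = fps_nth (F G) k"
      by (simp add: G[of k "Suc k"])
  qed
  have fixed_unique: "g = h" if "g = F g" "h = F h" for g h
  proof (rule fps_ext)
    fix k
    have "(F ^^ n) g = g" for n
      using that(1)[symmetric] by (induction n) simp_all
    moreover have "(F ^^ n) h = h" for n
      using that(2)[symmetric] by (induction n) simp_all
    ultimately show "fps_nth g k = fps_nth h k"
      using iter[OF lessI, of k g h] by (simp only:)
  qed
  have "\<exists>!g. g = F g"
    by (rule ex1I[of _ G], rule fixG, rule fixed_unique[OF _ fixG])
  then show ?thesis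
    unfolding F_def .
qed

lemma gser_eq:
  "(gser :: 'a::comm_ring_1 bpoly fps) = 1 + fps_X * gser * (Bser oo (fps_X ^ 2 * gser))"
  unfolding gser_def by (rule theI'[OF functional_equation_unique])

lemma bcoeff_empty: "bcoeff i p (\<lambda>_. 0) = (1 :: 'a::comm_ring_1)"
proof -
  have "fps_nth (gser :: 'a bpoly fps) 0 = 1"
    by (subst gser_eq) (simp add: fps_mult_nth_0)
  then show ?thesis
    by (simp add: bcoeff_def bmonom_def fps_nth_power_0 lookup_one)
qed

end

theory Submission
  imports Defs
begin

text \<open>
  The functional equation gives \<open>g\<^sup>m - 1 = (g - 1) (1 + g + \<dots> + g\<^bsup>m-1\<^esup>)\<close> with
  \<open>g - 1 = x g B(x\<^sup>2 g)\<close>, so \<open>g\<^sup>m - 1\<close> is the sum of \<open>b\<^sub>r x\<^bsup>2r+1\<^esup> g\<^bsup>j+1+r\<^esup>\<close> over \<open>r \<ge> 0\<close>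
  and \<open>0 \<le> j < m\<close>. The recurrence is the comparison of coefficients, with \<open>i = j + 1 + r\<close>.
\<close>

lemma fps_compose_nth_le:
  fixes a b :: "'a::comm_semiring_1 fps"
  assumes "fps_nth a 0 = 0" and "n \<le> N"
  shows "fps_nth (b oo a) n = (\<Sum>r\<le>N. fps_nth b r * fps_nth (a ^ r) n)"
  unfolding fps_compose_nth
  by (rule sum.mono_neutral_left) (use assms in \<open>auto simp: startsby_zero_power_prefix\<close>)

lemma fps_mult_compose_nth_le:
  fixes a b c :: "'a::comm_semiring_1 fps"
  assumes "fps_nth a 0 = 0" and "n \<le> N"
  shows "fps_nth (c * (b oo a)) n = (\<Sum>r\<le>N. fps_nth b r * fps_nth (c * a ^ r) n)"
proof -
  have "n - k \<le> N" for k
    using assms(2) by simp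
  then have "fps_nth (c * (b oo a)) n
      = (\<Sum>k=0..n. \<Sum>r\<le>N. fps_nth b r * (fps_nth c k * fps_nth (a ^ r) (n - k)))"
    using fps_compose_nth_le[OF assms(1), where N = N]
    by (simp add: fps_mult_nth sum_distrib_left mult.left_commute)
  also have "\<dots> = (\<Sum>r\<le>N. fps_nth b r * fps_nth (c * a ^ r) n)"
    by (subst sum.swap) (simp add: fps_mult_nth sum_distrib_left)
  finally show ?thesis .
qed

lemma fps_power_nth_of_eq_one_plus_mult_compose:
  fixes a b g h :: "'a::comm_ring_1 fps"
  assumes g: "g = 1 + h * (b oo a)" and a: "fps_nth a 0 = 0" and n: "n \<ge> 1" "n \<le> N"
  shows "fps_nth (g ^ m) n = (\<Sum>r\<le>N. fps_nth b r * (\<Sum>j<m. fps_nth (h * g ^ j * a ^ r) n))"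
proof -
  have "g ^ m - 1 = (g - 1) * (\<Sum>j<m. g ^ j)"
    by (rule power_diff_1_eq)
  also have "g - 1 = h * (b oo a)"
    by (subst g) simp
  finally have "g ^ m = 1 + (\<Sum>j<m. h * g ^ j) * (b oo a)"
    by (simp add: algebra_simps sum_distrib_left)
  then have "fps_nth (g ^ m) n = fps_nth ((\<Sum>j<m. h * g ^ j) * (b oo a)) n"
    using n(1) by simp
  also have "\<dots> = (\<Sum>r\<le>N. fps_nth b r * fps_nth ((\<Sum>j<m. h * g ^ j) * a ^ r) n)"
    by (rule fps_mult_compose_nth_le[OF a n(2)])
  finally show ?thesis
    by (simp add: sum_distrib_right fps_sum_nth)
qed

lemma gser_power_nth:
  assumes "n \<ge> 1" and "n \<le> N"
  shows "fps_nth ((gser :: 'a::comm_ring_1 bpoly fps) ^ m) n =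
    (\<Sum>r\<le>N. indet r * (\<Sum>i=r+1..m+r. fps_nth (fps_X ^ (2 * r + 1) * gser ^ i) n))"
proof -
  let ?g = "gser :: 'a bpoly fps"
  have monomial: "fps_X * ?g * ?g ^ j * (fps_X ^ 2 * ?g) ^ r
      = fps_X ^ (2 * r + 1) * ?g ^ (j + (r + 1))" for j r
    by (simp add: power_mult_distrib power_add mult_ac flip: power_mult)
  have reindex: "(\<Sum>i=r+1..m+r. f i) = (\<Sum>j<m. f (j + (r + 1)))"
    for f :: "nat \<Rightarrow> 'a bpoly" and r
    using sum.shift_bounds_nat_ivl[of f 0 "r + 1" m]
    by (simp add: lessThan_atLeast0 flip: atLeastLessThanSuc_atLeastAtMost)
  have "fps_nth (?g ^ m) n = (\<Sum>r\<le>N. fps_nth Bser r *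
      (\<Sum>j<m. fps_nth (fps_X * ?g * ?g ^ j * (fps_X ^ 2 * ?g) ^ r) n))"
    using assms
    by (intro fps_power_nth_of_eq_one_plus_mult_compose gser_eq) (simp_all add: fps_mult_nth_0)
  then show ?thesis
    by (simp only: monomial reindex Bser_def fps_nth_Abs_fps)
qed

lemma lookup_single_mult:
  fixes q :: "'b::monoid_add \<Rightarrow>\<^sub>0 'a::semiring_0"
  shows "Poly_Mapping.lookup (Poly_Mapping.single s c * q) k
    = c * (\<Sum>t. Poly_Mapping.lookup q t when k = s + t)"
  by (simp add: lookup_mult lookup_single when_mult)

lemma lookup_indet_mult:
  fixes q :: "'a::comm_ring_1 bpoly"
  shows "Poly_Mapping.lookup (indet r * q) k =
    (if Poly_Mapping.lookup k r = 0 then 0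
     else Poly_Mapping.lookup q (k - Poly_Mapping.single r 1))"
proof -
  have "k = Poly_Mapping.single r 1 + t \<longleftrightarrow>
      Poly_Mapping.lookup k r \<noteq> 0 \<and> t = k - Poly_Mapping.single r 1" for t
    by (auto simp: poly_mapping_eq_iff fun_eq_iff lookup_add lookup_minus lookup_single when_def)
  then show ?thesis
    by (simp add: indet_def lookup_single_mult)
qed

lemma lookup_bmonom: "Poly_Mapping.lookup (bmonom p e) r = (if r \<le> p then e r else 0)"
  by (auto simp: bmonom_def lookup_sum lookup_single when_def)

lemma bmonom_minus_single:
  "bmonom p e - Poly_Mapping.single r 1 = bmonom p (e(r := e r - 1))"
  by (rule poly_mapping_eqI) (simp add: lookup_minus lookup_bmonom lookup_single when_def)

lemma sum_mult_decrement:
  fixes e w :: "'b \<Rightarrow> nat"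
  assumes "finite A" and "r \<in> A" and "e r \<noteq> 0"
  shows "(\<Sum>i\<in>A. e i * w i) = w r + (\<Sum>i\<in>A. (e(r := e r - 1)) i * w i)"
proof -
  have "e r * w r = w r + (e r - 1) * w r"
    using assms(3) by (cases "e r") simp_all
  then show ?thesis
    using assms(1,2) by (simp add: sum.remove[of A r])
qed

lemma lookup_indet_mult_gser_power:
  "Poly_Mapping.lookup
      (indet r * fps_nth (fps_X ^ (2 * r + 1) * gser ^ i) (\<Sum>k\<le>p. e k * (2 * k + 1)))
      (bmonom p e) =
    (if r \<le> p \<and> e r \<noteq> 0 then bcoeff i p (e(r := e r - 1)) else (0 :: 'a::comm_ring_1))"
proof (cases "r \<le> p \<and> e r \<noteq> 0")
  case True
  then have "(\<Sum>k\<le>p. e k * (2 * k + 1))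
      = 2 * r + 1 + (\<Sum>k\<le>p. (e(r := e r - 1)) k * (2 * k + 1))"
    by (intro sum_mult_decrement) auto
  with True show ?thesis
    unfolding lookup_indet_mult lookup_bmonom bmonom_minus_single fps_X_power_mult_nth bcoeff_def
    by simp
next
  case False
  then show ?thesis
    by (auto simp: lookup_indet_mult lookup_bmonom)
qed

theorem theorem4:
  fixes m p :: nat and e :: "nat \<Rightarrow> nat"
  assumes "m \<ge> 1"
    and "(\<Sum>i\<le>p. e i * (2 * i + 1)) \<ge> 1"
  shows "(bcoeff m p e :: 'a::comm_ring_1) =
    (\<Sum>r\<le>p. \<Sum>i=r+1..m+r. if e r = 0 then 0 else bcoeff i p (e(r := e r - 1)))"
proof -
  let ?n = "\<Sum>i\<le>p. e i * (2 * i + 1)"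
  have "(bcoeff m p e :: 'a) = Poly_Mapping.lookup
      (\<Sum>r\<le>?n + p. indet r * (\<Sum>i=r+1..m+r. fps_nth (fps_X ^ (2 * r + 1) * gser ^ i) ?n))
      (bmonom p e)"
    unfolding bcoeff_def using assms(2) by (subst gser_power_nth[of ?n "?n + p"]) simp_all
  also have "\<dots> = (\<Sum>r\<le>?n + p. \<Sum>i=r+1..m+r.
      if r \<le> p \<and> e r \<noteq> 0 then bcoeff i p (e(r := e r - 1)) else 0)"
    by (simp only: lookup_sum sum_distrib_left lookup_indet_mult_gser_power)
  also have "\<dots> = (\<Sum>r\<le>p. \<Sum>i=r+1..m+r.
      if e r = 0 then 0 else bcoeff i p (e(r := e r - 1)))"
    by (rule sum.mono_neutral_cong_right) (auto intro!: sum.cong)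
  finally show ?thesis .
qed

end
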